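(* Let $G$ be a group, and suppose that $\operatorname{Aut}(G)$ admits homogeneous quasimorphisms that do not vanish identically on the subgroup $\operatorname{Inn}(G)$ of inner automorphisms. Then $G$ admits non-zero $\operatorname{Aut}(G)$-invariant homogeneous quasimorphisms.
   Context: A quasimorphism on a group $H$ is a function $f : H \to \mathbb{R}$ whose defect $D(f) := \sup_{g,h \in H} |f(g)+f(h)-f(gh)|$ is finite. It is homogeneous if its restriction to every cyclic subgroup is a homomorphism. A quasimorphism $f$ on $G$ is $\operatorname{Aut}$-invariant if $f \circ \phi = f$ for all $\phi \in \operatorname{Aut}(G)$. *)

theory Defs
  imports "HOL-Algebra.Algebra" "HOL-Library.Extended_Real"
begin

definition real_group :: "real monoid" where
  "real_group = \<lparr>carrier = UNIV, monoid.mult = (+), one = 0\<rparr>"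

(* A real-valued function on a group H is a HOL function of which only the values on
   carrier H matter. The defect lives in the extended reals, so that its finiteness is
   meaningful; the supremum is over a non-empty set, hence never -\<infinity>. *)
definition defect :: "('a, 'b) monoid_scheme \<Rightarrow> ('a \<Rightarrow> real) \<Rightarrow> ereal" where
  "defect H f =
    (SUP (g, h) \<in> carrier H \<times> carrier H. ereal \<bar>f g + f h - f (g \<otimes>\<^bsub>H\<^esub> h)\<bar>)"

definition quasimorphism :: "('a, 'b) monoid_scheme \<Rightarrow> ('a \<Rightarrow> real) \<Rightarrow> bool" where
  "quasimorphism H f \<longleftrightarrow> defect H f < \<infinity>"

definition homogeneous :: "('a, 'b) monoid_scheme \<Rightarrow> ('a \<Rightarrow> real) \<Rightarrow> bool" where
  "homogeneous H f \<longleftrightarrow>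
    (\<forall>g \<in> carrier H. f \<in> hom (subgroup_generated H {g}) real_group)"

definition Aut_invariant :: "('a, 'b) monoid_scheme \<Rightarrow> ('a \<Rightarrow> real) \<Rightarrow> bool" where
  "Aut_invariant G f \<longleftrightarrow> (\<forall>\<phi> \<in> auto G. \<forall>g \<in> carrier G. (f \<circ> \<phi>) g = f g)"

(* Restricted to the carrier because the elements of AutoGroup G are extensional. *)
definition inner_aut :: "('a, 'b) monoid_scheme \<Rightarrow> 'a \<Rightarrow> 'a \<Rightarrow> 'a" where
  "inner_aut G g = (\<lambda>x \<in> carrier G. g \<otimes>\<^bsub>G\<^esub> x \<otimes>\<^bsub>G\<^esub> inv\<^bsub>G\<^esub> g)"

definition Inn :: "('a, 'b) monoid_scheme \<Rightarrow> ('a \<Rightarrow> 'a) set" where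
  "Inn G = inner_aut G ` carrier G"

lemma quasimorphism_iff_bounded:
  assumes "group H"
  shows "quasimorphism H f \<longleftrightarrow>
    (\<exists>D. \<forall>g \<in> carrier H. \<forall>h \<in> carrier H. \<bar>f g + f h - f (g \<otimes>\<^bsub>H\<^esub> h)\<bar> \<le> D)"
proof
  assume q: "quasimorphism H f"
  have le: "ereal \<bar>f g + f h - f (g \<otimes>\<^bsub>H\<^esub> h)\<bar> \<le> defect H f"
    if "g \<in> carrier H" "h \<in> carrier H" for g h
    unfolding defect_def using that by (intro SUP_upper2[of "(g, h)"]) auto
  have "\<one>\<^bsub>H\<^esub> \<in> carrier H"
    using assms by (simp add: group.is_monoid)
  from le[OF this this] q have "\<bar>defect H f\<bar> \<noteq> \<infinity>"
    unfolding quasimorphism_def by (cases "defect H f") auto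
  then obtain D where "defect H f = ereal D"
    by (cases "defect H f") auto
  with le show "\<exists>D. \<forall>g \<in> carrier H. \<forall>h \<in> carrier H. \<bar>f g + f h - f (g \<otimes>\<^bsub>H\<^esub> h)\<bar> \<le> D"
    by auto
next
  assume "\<exists>D. \<forall>g \<in> carrier H. \<forall>h \<in> carrier H. \<bar>f g + f h - f (g \<otimes>\<^bsub>H\<^esub> h)\<bar> \<le> D"
  then obtain D where
    "\<forall>g \<in> carrier H. \<forall>h \<in> carrier H. \<bar>f g + f h - f (g \<otimes>\<^bsub>H\<^esub> h)\<bar> \<le> D"
    by blast
  then have "defect H f \<le> ereal D"
    unfolding defect_def by (intro SUP_least) auto
  then show "quasimorphism H f"
    unfolding quasimorphism_def by (cases "defect H f") auto
qed

context group
begin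

lemma inner_aut_mult:
  assumes "g \<in> carrier G" "h \<in> carrier G"
  shows "compose (carrier G) (inner_aut G g) (inner_aut G h) = inner_aut G (g \<otimes> h)"
  using assms by (auto simp: compose_def inner_aut_def inv_mult_group m_assoc)

lemma inner_aut_one: "inner_aut G \<one> = (\<lambda>x \<in> carrier G. x)"
  by (auto simp: inner_aut_def)

lemma inner_aut_auto:
  assumes g: "g \<in> carrier G"
  shows "inner_aut G g \<in> auto G"
proof -
  have c: "inner_aut G h \<in> carrier G \<rightarrow> carrier G" if "h \<in> carrier G" for h
    using that by (auto simp: inner_aut_def)
  have i: "inner_aut G h (inner_aut G (inv h) x) = x"
    if "h \<in> carrier G" "x \<in> carrier G" for h x
    using that inner_aut_mult[of h "inv h"] inner_aut_one
    by (metis compose_eq inv_closed r_inv restrict_apply')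
  have "bij_betw (inner_aut G g) (carrier G) (carrier G)"
    using c g i[of g] i[of "inv g"]
    by (intro bij_betwI[where g = "inner_aut G (inv g)"]) auto
  moreover have "inv g \<otimes> (g \<otimes> z) = z" if "z \<in> carrier G" for z
    using g that by (simp flip: m_assoc)
  then have "inner_aut G g \<in> hom G G"
    using g by (auto simp: hom_def inner_aut_def m_assoc)
  ultimately show ?thesis
    by (auto simp: auto_def Bij_def inner_aut_def)
qed

lemma inner_aut_hom: "inner_aut G \<in> hom G (AutoGroup G)"
proof (rule homI)
  fix g h assume "g \<in> carrier G" "h \<in> carrier G"
  then show "inner_aut G (g \<otimes> h) = inner_aut G g \<otimes>\<^bsub>AutoGroup G\<^esub> inner_aut G h"
    using inner_aut_auto[of g] inner_aut_auto[of h]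
    by (simp add: AutoGroup_def BijGroup_def auto_def inner_aut_mult)
qed (simp add: AutoGroup_def inner_aut_auto)

lemma subgroup_Inn: "subgroup (Inn G) (AutoGroup G)"
proof -
  interpret group_hom G "AutoGroup G" "inner_aut G"
    by (intro group_hom.intro group_hom_axioms.intro is_group AutoGroup inner_aut_hom)
  show ?thesis
    unfolding Inn_def by (rule img_is_subgroup)
qed

end

end

theory Submission
  imports Defs
begin

text \<open>
  If f is a homogeneous quasimorphism on Aut(G), its pullback along the map from G to Aut(G)
  sending g to the inner automorphism of g is one on G. For an automorphism \<open>\<phi>\<close>, the inner
  automorphism of \<open>\<phi> g\<close> is the conjugate by \<open>\<phi>\<close> of that of g, so the pullback is invariant
  because homogeneous quasimorphisms are constant on conjugacy classes: conjugating by a fixed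
  element changes f by a bounded amount, and applying this bound to the powers \<open>x\<^sup>n\<close> shows that
  n times the change at x is bounded independently of n.
\<close>

lemma quasimorphism_comp_hom:
  assumes "group G" "group H" "h \<in> hom G H" "quasimorphism H f"
  shows "quasimorphism G (f \<circ> h)"
proof -
  obtain D where D: "\<And>x y. x \<in> carrier H \<Longrightarrow> y \<in> carrier H \<Longrightarrow>
      \<bar>f x + f y - f (x \<otimes>\<^bsub>H\<^esub> y)\<bar> \<le> D"
    using assms quasimorphism_iff_bounded by blast
  have "\<bar>(f \<circ> h) x + (f \<circ> h) y - (f \<circ> h) (x \<otimes>\<^bsub>G\<^esub> y)\<bar> \<le> D"
    if "x \<in> carrier G" "y \<in> carrier G" for x y
    using D[of "h x" "h y"] that hom_mult[OF assms(3)] hom_in_carrier[OF assms(3)] by simp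
  then show ?thesis
    using quasimorphism_iff_bounded[OF assms(1)] by blast
qed

text \<open>The subgroup generated by \<open>g\<close> consists of the integer powers of
  \<open>g\<close>, so being a homomorphism there amounts to additivity in the exponent. In this
  form homogeneity passes along homomorphisms, which commute with integer powers.\<close>

lemma (in group) homogeneous_iff_int_pow:
  "homogeneous G f \<longleftrightarrow>
    (\<forall>g \<in> carrier G. \<forall>j k :: int. f (g [^] (j + k)) = f (g [^] j) + f (g [^] k))"
  by (auto simp: homogeneous_def hom_def real_group_def carrier_subgroup_generated_by_singleton
      int_pow_mult)

lemma homogeneous_comp_hom:
  assumes "group G" "group H" "h \<in> hom G H" "homogeneous H f"
  shows "homogeneous G (f \<circ> h)"
proof -
  interpret group_hom G H h
    using assms by (simp add: group_hom_def group_hom_axioms_def)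
  show ?thesis
    using assms(4) by (simp add: G.homogeneous_iff_int_pow H.homogeneous_iff_int_pow hom_int_pow)
qed

lemma (in group) homogeneous_nat_pow:
  assumes "homogeneous G f" "g \<in> carrier G"
  shows "f (g [^] (n :: nat)) = real n * f g"
proof -
  have add: "f (g [^] (j + k)) = f (g [^] j) + f (g [^] k)" for j k :: int
    using assms homogeneous_iff_int_pow by blast
  have "f (g [^] int n) = real n * f g"
  proof (induction n)
    case 0
    \<comment> \<open>Exponents 0 and 0 give f(1) = 2 f(1), hence f(1) = 0.\<close>
    show ?case using add[of 0 0] by simp
  next
    case (Suc n)
    then show ?case using add[of 1 "int n"] assms(2) by (simp add: algebra_simps)
  qed
  then show ?thesis by (simp add: int_pow_int)
qed

lemma (in group) homogeneous_quasimorphism_conj: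
  assumes q: "quasimorphism G f" and hom: "homogeneous G f"
    and h: "h \<in> carrier G" and x: "x \<in> carrier G"
  shows "f (h \<otimes> x \<otimes> inv h) = f x"
proof -
  obtain D where D: "\<And>x y. x \<in> carrier G \<Longrightarrow> y \<in> carrier G \<Longrightarrow> \<bar>f x + f y - f (x \<otimes> y)\<bar> \<le> D"
    using q quasimorphism_iff_bounded[OF is_group] by blast
  \<comment> \<open>The defect bound is used twice, to split off \<open>h\<close> on the left and
    then \<open>inv h\<close> on the right; what remains, \<open>f h + f (inv h)\<close>, does not
    depend on the conjugated element.\<close>
  define C where "C = 2 * D + \<bar>f h + f (inv h)\<bar>"
  have bound: "\<bar>f (h \<otimes> y \<otimes> inv h) - f y\<bar> \<le> C" if "y \<in> carrier G" for y
    using D[of h y] D[of "h \<otimes> y" "inv h"] h that unfolding C_def by auto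
  \<comment> \<open>Conjugation by \<open>h\<close> is an endomorphism, so it commutes with taking
    powers.\<close>
  interpret conj: group_hom G G "inner_aut G h"
    using inner_aut_auto[OF h]
    by (simp add: group_hom_def group_hom_axioms_def auto_def is_group)
  have "real n * \<bar>f (h \<otimes> x \<otimes> inv h) - f x\<bar> \<le> C" for n
  proof -
    have "(h \<otimes> x \<otimes> inv h) [^] n = h \<otimes> x [^] n \<otimes> inv h"
      using conj.hom_nat_pow[of x n] h x by (simp add: inner_aut_def)
    then have "f (h \<otimes> x [^] n \<otimes> inv h) = real n * f (h \<otimes> x \<otimes> inv h)"
      using homogeneous_nat_pow[OF hom, of "h \<otimes> x \<otimes> inv h" n] h x by simp
    then show ?thesis
      using bound[of "x [^] n"] homogeneous_nat_pow[OF hom x, of n] x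
      by (simp add: abs_mult flip: right_diff_distrib)
  qed
  \<comment> \<open>By the Archimedean property, the multiples of a positive real would exceed
    \<open>C\<close>.\<close>
  then have "\<not> 0 < \<bar>f (h \<otimes> x \<otimes> inv h) - f x\<bar>"
    by (meson reals_Archimedean3 not_less)
  then show ?thesis by simp
qed

lemma (in group) inner_aut_apply_auto:
  assumes p: "\<phi> \<in> auto G" and g: "g \<in> carrier G"
  shows "inner_aut G (\<phi> g) =
    \<phi> \<otimes>\<^bsub>AutoGroup G\<^esub> inner_aut G g \<otimes>\<^bsub>AutoGroup G\<^esub> inv\<^bsub>AutoGroup G\<^esub> \<phi>"
proof -
  interpret A: group "AutoGroup G" by (rule AutoGroup)
  interpret p: group_hom G G \<phi>
    using p by (simp add: group_hom_def group_hom_axioms_def auto_def is_group)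
  have carr: "carrier (AutoGroup G) = auto G"
    by (simp add: AutoGroup_def)
  have Bij: "\<psi> \<in> Bij (carrier G)" if "\<psi> \<in> auto G" for \<psi>
    using that by (simp add: auto_def)
  have mult: "\<psi> \<otimes>\<^bsub>AutoGroup G\<^esub> \<chi> = compose (carrier G) \<psi> \<chi>"
    if "\<psi> \<in> auto G" "\<chi> \<in> auto G" for \<psi> \<chi>
    using Bij that by (simp add: AutoGroup_def BijGroup_def)
  have pg: "\<phi> g \<in> carrier G" using g by simp
  \<comment> \<open>Both sides send x to \<phi>(g) \<phi>(x) \<phi>(g)^-1. Moving \<phi> across the
    equation avoids evaluating its inverse in \<open>AutoGroup G\<close>.\<close>
  have "inner_aut G (\<phi> g) \<otimes>\<^bsub>AutoGroup G\<^esub> \<phi> = \<phi> \<otimes>\<^bsub>AutoGroup G\<^esub> inner_aut G g"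
    using p g pg unfolding mult[OF inner_aut_auto[OF pg] p] mult[OF p inner_aut_auto[OF g]]
    by (auto simp: compose_def inner_aut_def)
  then show ?thesis
    using p g pg inner_aut_auto A.inv_solve_right[of "inner_aut G (\<phi> g)"
        "\<phi> \<otimes>\<^bsub>AutoGroup G\<^esub> inner_aut G g" \<phi>]
    by (metis A.m_closed carr)
qed

theorem lemma4:
  fixes G :: "('a, 'b) monoid_scheme"
  assumes "group G"
    and "\<exists>f. quasimorphism (AutoGroup G) f \<and> homogeneous (AutoGroup G) f
           \<and> (\<exists>\<phi> \<in> Inn G. f \<phi> \<noteq> 0)"
  shows "\<exists>f. quasimorphism G f \<and> homogeneous G f \<and> Aut_invariant G f
           \<and> (\<exists>g \<in> carrier G. f g \<noteq> 0)"
proof -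
  interpret group G by fact
  interpret A: group "AutoGroup G" by (rule AutoGroup)
  obtain f where f: "quasimorphism (AutoGroup G) f" "homogeneous (AutoGroup G) f"
    and nz: "\<exists>\<phi> \<in> Inn G. f \<phi> \<noteq> 0"
    using assms(2) by blast
  let ?f = "f \<circ> inner_aut G"
  have "quasimorphism G ?f" "homogeneous G ?f"
    using quasimorphism_comp_hom homogeneous_comp_hom is_group A.is_group inner_aut_hom f
    by blast+
  moreover have "Aut_invariant G ?f"
    unfolding Aut_invariant_def
  proof (intro ballI)
    fix \<phi> g assume "\<phi> \<in> auto G" "g \<in> carrier G"
    then show "(?f \<circ> \<phi>) g = ?f g"
      using A.homogeneous_quasimorphism_conj[OF f, of \<phi> "inner_aut G g"] inner_aut_auto
      by (simp add: inner_aut_apply_auto) (simp add: AutoGroup_def)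
  qed
  \<comment> \<open>An inner automorphism on which \<open>f\<close> is non-zero has the form
    \<open>inner_aut G g\<close>, and this \<open>g\<close> is the witness.\<close>
  moreover have "\<exists>g \<in> carrier G. ?f g \<noteq> 0"
    using nz by (auto simp: Inn_def)
  ultimately show ?thesis by blast
qed

end
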